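(* Let $m,n,r$ be positive integers, $L>0$, $\eta>0$, and let $\ell:\mathbb{R}^{m\times n}\to\mathbb{R}$ be differentiable with $L$-Lipschitz gradient, i.e. $\|\nabla\ell(\mathbf{W})-\nabla\ell(\mathbf{W}')\|_{\mathrm F}\le L\|\mathbf{W}-\mathbf{W}'\|_{\mathrm F}$ for all $\mathbf{W},\mathbf{W}'\in\mathbb{R}^{m\times n}$. Let $\mathbf{W}_t\in\mathbb{R}^{m\times n}$, $\mathbf{A}_t\in\mathbb{R}^{m\times r}$, $\mathbf{B}_t\in\mathbb{R}^{n\times r}$ satisfy $\|\mathbf{A}_t^\top\nabla\ell(\mathbf{W}_t)\|_{\mathrm F}\,\|\nabla\ell(\mathbf{W}_t)\mathbf{B}_t\|_{\mathrm F}\neq 0$. Define $$\mathbf{S}_t^A:=\begin{bmatrix}\mathbf{A}_t & \nabla\ell(\mathbf{W}_t)\mathbf{B}_t\end{bmatrix}\in\mathbb{R}^{m\times 2r},\qquad \mathbf{S}_t^B:=\begin{bmatrix}\nabla\ell(\mathbf{W}_t)^\top\mathbf{A}_t & \mathbf{B}_t\end{bmatrix}\in\mathbb{R}^{n\times 2r},$$ $$\boldsymbol{\lambda}_t:=\begin{bmatrix}\|\mathbf{A}_t^\top\nabla\ell(\mathbf{W}_t)\|_{\mathrm{row}}^2\\ \|\mathbf{B}_t^\top\nabla\ell(\mathbf{W}_t)^\top\|_{\mathrm{row}}^2\end{bmatrix}\in\mathbb{R}^{2r}.$$ If the linear system $$\big[(\mathbf{S}_t^{A\top}\mathbf{S}_t^A)\odot(\mathbf{S}_t^{B\top}\mathbf{S}_t^B)\big]\mathbf{v}_t=\boldsymbol{\lambda}_t$$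 has an entrywise non-negative solution $\mathbf{v}_t\in\mathbb{R}_+^{2r}$, then $$\begin{bmatrix}\boldsymbol{\alpha}_t^*\\ \boldsymbol{\beta}_t^*\end{bmatrix}=\pm\frac{1}{\sqrt{L\eta}}\,\mathbf{v}_t^{\circ\frac12}$$ is a global minimizer over $(\boldsymbol{\alpha}_t,\boldsymbol{\beta}_t)\in\mathbb{R}^r\times\mathbb{R}^r$ of $$\frac{L}{2}\Big\|\frac{1}{L}\nabla\ell(\mathbf{W}_t)-\eta\,\nabla\ell(\mathbf{W}_t)\mathbf{B}_t\operatorname{diag}^2(\boldsymbol{\beta}_t)\mathbf{B}_t^\top-\eta\,\mathbf{A}_t\operatorname{diag}^2(\boldsymbol{\alpha}_t)\mathbf{A}_t^\top\nabla\ell(\mathbf{W}_t)\Big\|_{\mathrm F}^2 .$$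
   Context: $\|\cdot\|_{\mathrm F}$ is the Frobenius norm and $\odot$ the Hadamard (entrywise) product. $\mathbb{R}_+$ denotes the non-negative reals. For a vector $\mathbf{v}$, $\operatorname{diag}(\mathbf{v})$ is the diagonal matrix with diagonal $\mathbf{v}$ and $\operatorname{diag}^2(\mathbf{v})=\operatorname{diag}(\mathbf{v})^2$; $\mathbf{v}^{\circ\frac12}$ is the entrywise square root, and the sign $\pm$ may be chosen independently in each entry. For a matrix $\mathbf{M}$ with $k$ rows, $\|\mathbf{M}\|_{\mathrm{row}}^2\in\mathbb{R}^k$ is the vector whose $i$-th entry is the squared Euclidean norm $\|\mathbf{M}_{i,:}\|_2^2$ of the $i$-th row of $\mathbf{M}$. In the paper, $\mathbf{W}_t$ is the weight matrix at step $t$, $\mathbf{A}_t,\mathbf{B}_t$ are the low-rank adapters, $\eta$ is the learning rate, and the objective arises from replacing $(\mathbf{A}_t,\mathbf{B}_t)$ by the column-scaled adapters $(\mathbf{A}_t\operatorname{diag}(\boldsymbol{\alpha}_t),\mathbf{B}_t\operatorname{diag}(\boldsymbol{\beta}_t))$. *)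

theory Defs
  imports "HOL-Analysis.Analysis"
begin

text \<open>
  A real matrix with rows indexed by \<open>'m\<close> and columns by \<open>'n\<close> has type \<open>real^'n^'m\<close>; the indices
  of a \<open>2r\<close>-dimensional vector form the sum type \<open>'r + 'r\<close>, with \<open>Inl\<close> the first block and \<open>Inr\<close>
  the second. The library's \<open>norm\<close> on matrices is the Frobenius norm, its inner product is the
  Frobenius inner product, and its \<open>*\<close> is the Hadamard product (the matrix product is \<open>**\<close>).
\<close>

lemma norm_matrix_Frobenius:
  fixes M :: "real^'n^'m"
  shows "norm M = sqrt (\<Sum>i\<in>UNIV. \<Sum>j\<in>UNIV. (M $ i $ j)\<^sup>2)"
  by (simp add: norm_vec_def L2_set_def sum_nonneg)

lemma inner_matrix_Frobenius:
  fixes M N :: "real^'n^'m"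
  shows "inner M N = (\<Sum>i\<in>UNIV. \<Sum>j\<in>UNIV. M $ i $ j * N $ i $ j)"
  by (simp add: inner_vec_def)

lemma times_matrix_Hadamard:
  fixes M N :: "real^'n^'m"
  shows "(M * N) $ i $ j = M $ i $ j * N $ i $ j"
  by simp

definition gradient :: "('a::euclidean_space \<Rightarrow> real) \<Rightarrow> 'a \<Rightarrow> 'a" where
  "gradient f x = (THE D. GDERIV f x :> D)"

lemma GDERIV_unique:
  fixes f :: "'a::euclidean_space \<Rightarrow> real"
  assumes "GDERIV f x :> D" "GDERIV f x :> E"
  shows "D = E"
proof -
  have "(\<lambda>h. inner h D) = (\<lambda>h. inner h E)"
    using assms unfolding gderiv_def by (rule has_derivative_unique)
  then have "inner h D = inner h E" for h
    by (rule fun_cong)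
  then show ?thesis
    by (metis vector_eq_ldot)
qed

lemma GDERIV_gradient:
  fixes f :: "'a::euclidean_space \<Rightarrow> real"
  assumes "f differentiable (at x)"
  shows "GDERIV f x :> gradient f x"
proof -
  obtain f' where f': "(f has_derivative f') (at x)"
    using assms by (auto simp: differentiable_def)
  then have "linear f'"
    by (rule has_derivative_linear)
  then have "f' h = inner h (adjoint f' 1)" for h
    using adjoint_works[of f' h 1] by simp
  then have "GDERIV f x :> adjoint f' 1"
    using f' unfolding gderiv_def by (metis ext)
  then show ?thesis
    unfolding gradient_def by (metis theI GDERIV_unique)
qed

definition diag :: "real^'k \<Rightarrow> real^'k^'k" where
  "diag v = (\<chi> i j. if i = j then v $ i else 0)"

definition vcat :: "real^'a \<Rightarrow> real^'b \<Rightarrow> real^('a + 'b)" where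
  "vcat x y = (\<chi> k. case k of Inl i \<Rightarrow> x $ i | Inr j \<Rightarrow> y $ j)"

definition hcat :: "real^'a^'k \<Rightarrow> real^'b^'k \<Rightarrow> real^('a + 'b)^'k" where
  "hcat X Y = (\<chi> i. vcat (row i X) (row i Y))"

definition row_sqnorm :: "real^'b^'k \<Rightarrow> real^'k" where
  "row_sqnorm M = (\<chi> i. (norm (row i M))\<^sup>2)"

end

theory Submission
  imports Defs
begin

text \<open>
  Write \<open>a\<^sub>k\<close>, \<open>b\<^sub>k\<close> for the columns of \<open>SA\<close>, \<open>SB\<close> and \<open>P\<^sub>k = a\<^sub>k b\<^sub>k\<^sup>T\<close>. In the squared entries
  \<open>x = (\<alpha>\<^sup>2, \<beta>\<^sup>2)\<close> the objective is the linear least squares problem of approximating \<open>G / L\<close> by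
  \<open>\<eta> \<Sum>\<^sub>k x\<^sub>k P\<^sub>k\<close>. The Gram matrix of the \<open>P\<^sub>k\<close> is the Hadamard product of those of the columns, and
  \<open>\<langle>P\<^sub>k, G\<rangle>\<close> is the \<open>k\<close>-th entry of \<open>lam\<close>, so the linear system is the system of normal equations
  for \<open>x = v / (L \<eta>)\<close>. Non-negativity of \<open>v\<close> makes this optimal \<open>x\<close> a vector of squares.
\<close>

text \<open>Orthogonality to every \<open>P k\<close> makes the residual at \<open>x\<close>
  orthogonal to the difference of the two combinations, so Pythagoras splits the squared residual at
  \<open>y\<close>.\<close>

lemma least_squares_normal_equations:
  fixes P :: "'k \<Rightarrow> 'a::real_inner"
  assumes "\<And>k. k \<in> K \<Longrightarrow> inner (P k) (g - (\<Sum>l\<in>K. x l *\<^sub>R P l)) = 0"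
  shows "norm (g - (\<Sum>l\<in>K. x l *\<^sub>R P l)) \<le> norm (g - (\<Sum>l\<in>K. y l *\<^sub>R P l))"
proof -
  define R where "R = g - (\<Sum>l\<in>K. x l *\<^sub>R P l)"
  define D where "D = (\<Sum>l\<in>K. (x l - y l) *\<^sub>R P l)"
  have "inner D R = 0"
    using assms by (simp add: D_def R_def inner_sum_left)
  then have "orthogonal R D"
    by (simp add: orthogonal_def inner_commute)
  then have "(norm R)\<^sup>2 \<le> (norm (R + D))\<^sup>2"
    by (simp add: norm_add_Pythagorean)
  moreover have "R + D = g - (\<Sum>l\<in>K. y l *\<^sub>R P l)"
    by (simp add: R_def D_def scaleR_diff_left sum_subtractf)
  ultimately show ?thesis
    unfolding R_def[symmetric] by simp
qed

definition outer :: "real^'m \<Rightarrow> real^'n \<Rightarrow> real^'n^'m" where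
  "outer a b = (\<chi> i j. a $ i * b $ j)"

lemma inner_outer_outer: "inner (outer a b) (outer c d) = inner a c * inner b d"
  by (simp add: outer_def inner_vec_def sum_product) (simp add: mult_ac)

lemma inner_outer_left: "inner (outer a b) M = inner a (M *v b)"
  by (simp add: outer_def inner_vec_def matrix_vector_mult_def sum_distrib_left mult_ac)

lemma diag_mult_diag: "diag c ** diag c = diag (\<chi> k. (c $ k)\<^sup>2)"
  by (auto simp: diag_def matrix_matrix_mult_def vec_eq_iff power2_eq_square
      if_distrib[where f = "\<lambda>x. x * _"] cong: if_cong)

text \<open>This is what makes both terms of the objective linear in the squared entries.\<close>

lemma mult_diag_transpose_eq_sum_outer:
  "X ** diag d ** transpose Y = (\<Sum>k\<in>UNIV. d $ k *\<^sub>R outer (column k X) (column k Y))"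
  by (simp add: vec_eq_iff diag_def matrix_matrix_mult_def transpose_def outer_def column_def
      if_distrib[where f = "\<lambda>x. _ * x"] mult_ac cong: if_cong)

lemma column_hcat [simp]:
  "column (Inl i) (hcat X Y) = column i X"
  "column (Inr j) (hcat X Y) = column j Y"
  by (simp_all add: column_def hcat_def vcat_def row_def vec_eq_iff)

lemma sum_UNIV_Plus:
  fixes f :: "'a::finite + 'b::finite \<Rightarrow> 'c::comm_monoid_add"
  shows "(\<Sum>k\<in>UNIV. f k) = (\<Sum>i\<in>UNIV. f (Inl i)) + (\<Sum>j\<in>UNIV. f (Inr j))"
  by (simp add: UNIV_Plus_UNIV[symmetric] sum.Plus del: UNIV_Plus_UNIV)

lemma column_matrix_mult: "column k (M ** N) = M *v column k N"
  by (simp add: column_def matrix_matrix_mult_def matrix_vector_mult_def vec_eq_iff)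

lemma row_transpose_mult:
  fixes M :: "'a::comm_semiring_1^'k^'m"
  shows "row k (transpose M ** N) = transpose N *v column k M"
  by (simp add: row_def column_def matrix_matrix_mult_def matrix_vector_mult_def transpose_def
      vec_eq_iff mult.commute)

lemma transpose_mult_nth: "(transpose M ** N) $ k $ l = inner (column k M) (column l N)"
  by (simp add: matrix_matrix_mult_def transpose_def inner_vec_def column_def)

theorem theorem3p7:
  fixes loss :: "real^'n^'m \<Rightarrow> real"
    and L \<eta> :: real
    and W G :: "real^'n^'m"
    and A :: "real^'r^'m"
    and B :: "real^'r^'n"
    and SA :: "real^('r + 'r)^'m"
    and SB :: "real^('r + 'r)^'n"
    and lam v \<sigma> :: "real^('r + 'r)"
    and \<alpha>' \<beta>' :: "real^'r"
  assumes "L > 0" and "\<eta> > 0"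
    and "\<forall>X. loss differentiable (at X)"
    and "\<forall>X Y. norm (gradient loss X - gradient loss Y) \<le> L * norm (X - Y)"
    and "G = gradient loss W"
    and "norm (transpose A ** G) * norm (G ** B) \<noteq> 0"
    and "SA = hcat A (G ** B)"
    and "SB = hcat (transpose G ** A) B"
    and "lam = vcat (row_sqnorm (transpose A ** G)) (row_sqnorm (transpose B ** transpose G))"
    and "((transpose SA ** SA) * (transpose SB ** SB)) *v v = lam"
    and "\<forall>k. v $ k \<ge> 0"
    and "\<forall>k. \<sigma> $ k \<in> {1, -1}"
    and "vcat \<alpha>' \<beta>' = (1 / sqrt (L * \<eta>)) *\<^sub>R (\<chi> k. \<sigma> $ k * sqrt (v $ k))"
  shows "is_arg_min
    (\<lambda>(\<alpha>, \<beta>). L / 2 *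
       (norm ((1 / L) *\<^sub>R G
              - \<eta> *\<^sub>R (G ** B ** (diag \<beta> ** diag \<beta>) ** transpose B)
              - \<eta> *\<^sub>R (A ** (diag \<alpha> ** diag \<alpha>) ** transpose A ** G)))\<^sup>2)
    (\<lambda>_. True) (\<alpha>', \<beta>')"
proof -
  define P where "P k = outer (column k SA) (column k SB)" for k
  define F where "F x = (1 / L) *\<^sub>R G - (\<Sum>k\<in>UNIV. (\<eta> * x k) *\<^sub>R P k)" for x
  define q where "q \<alpha> \<beta> k = ((vcat \<alpha> \<beta>) $ k)\<^sup>2" for \<alpha> \<beta> :: "real^'r" and k
  note [simp] = \<open>SA = _\<close> \<open>SB = _\<close>
  have residual: "(1 / L) *\<^sub>R G
      - \<eta> *\<^sub>R (G ** B ** (diag \<beta> ** diag \<beta>) ** transpose B)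
      - \<eta> *\<^sub>R (A ** (diag \<alpha> ** diag \<alpha>) ** transpose A ** G) = F (q \<alpha> \<beta>)" for \<alpha> \<beta>
  proof -
    \<comment> \<open>The trailing \<open>G\<close> is absorbed into the transposed factor, which
      becomes the first block of \<open>SB\<close>.\<close>
    have "A ** (diag \<alpha> ** diag \<alpha>) ** transpose A ** G =
        A ** (diag \<alpha> ** diag \<alpha>) ** transpose (transpose G ** A)"
      by (simp add: matrix_transpose_mul transpose_transpose matrix_mul_assoc)
    then show ?thesis
      by (simp add: F_def P_def q_def vcat_def sum_UNIV_Plus diag_mult_diag
          mult_diag_transpose_eq_sum_outer scaleR_sum_right)
  qed
  have inner_P_G: "inner (P k) G = lam $ k" for k
  proof (cases k)
    case (Inl i)
    then show ?thesis
      \<comment> \<open>With \<open>a = column i A\<close>, the left side is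
        \<open>inner a (G *v (transpose G *v a))\<close>; moving \<open>G\<close> to the other side
        gives the squared norm of \<open>transpose G *v a\<close>.\<close>
      by (simp add: \<open>lam = _\<close> P_def inner_outer_left vcat_def row_sqnorm_def column_matrix_mult
          row_transpose_mult power2_norm_eq_inner transpose_matrix_vector flip: dot_lmul_matrix)
  next
    case (Inr j)
    then show ?thesis
      by (simp add: \<open>lam = _\<close> P_def inner_outer_left vcat_def row_sqnorm_def column_matrix_mult
          row_transpose_mult power2_norm_eq_inner transpose_transpose)
  qed
  have gram: "(\<Sum>l\<in>UNIV. v $ l * inner (P k) (P l)) = lam $ k" for k
    by (subst assms(10)[symmetric]) (simp add: P_def inner_outer_outer matrix_vector_mult_def
        transpose_mult_nth mult_ac del: \<open>SA = _\<close> \<open>SB = _\<close>)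
  \<comment> \<open>Squaring removes the signs, and \<open>v $ k \<ge> 0\<close> lets the squared
    root return \<open>v $ k\<close>.\<close>
  have q_opt: "q \<alpha>' \<beta>' k = v $ k / (L * \<eta>)" for k
  proof -
    have "(\<sigma> $ k)\<^sup>2 = 1"
      using assms(12) by (auto simp: power2_eq_square dest!: spec[of _ k])
    then show ?thesis
      using assms(1,2,11) by (simp add: q_def assms(13) power_mult_distrib power_divide)
  qed
  have "inner (P k) (F (q \<alpha>' \<beta>')) = 0" for k
  proof -
    \<comment> \<open>The \<open>\<eta>\<close> in \<open>F\<close> cancels the one in
      \<open>q_opt\<close>, leaving the common factor \<open>1 / L\<close>.\<close>
    have "inner (P k) (F (q \<alpha>' \<beta>')) = (1 / L) * lam $ k - (\<Sum>l\<in>UNIV. (1 / L) * (v $ l * inner (P k) (P l)))"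
      using assms(1,2) by (simp add: F_def q_opt inner_diff_right inner_sum_right inner_P_G)
    then show ?thesis
      by (simp add: gram flip: sum_distrib_left sum_divide_distrib)
  qed
  \<comment> \<open>Here \<open>y\<close> is any real coefficient family, in particular any
    \<open>q \<alpha> \<beta>\<close>.\<close>
  then have "norm (F (q \<alpha>' \<beta>')) \<le> norm (F y)" for y
    unfolding F_def by (rule least_squares_normal_equations)
  then show ?thesis
    using \<open>L > 0\<close> by (auto simp: is_arg_min_linorder residual power_mono)
qed

end
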